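(* Let $\beta>0$ and $\alpha>0$. Let $\boldsymbol\zeta=(x_s,y_s):I\to\mathbb{R}^2$ be a smooth path on an interval $I$, parametrized by a path coordinate $\tau\in I$, with $\boldsymbol\zeta'(\tau)\neq 0$ for all $\tau$. Let $t\mapsto\tau(t)$ be a smooth map from an interval $K$ to $I$ with $\dot\tau(t)>0$ for all $t\in K$. Let $\Phi$ denote the flat state map of the slider-pusher system, giving the full state $\mathbf{x}=(x_s,y_s,\theta_s,c,x_p,y_p,\theta_p)$ of slider and pusher. Then the state is invariant to the time differential properties $\dot\tau,\ddot\tau,\dots$ of the path coordinate: writing $\tilde{\boldsymbol\zeta}(t)=\boldsymbol\zeta(\tau(t))$, for every $t\in K$, $$\Phi\big(\tilde{\boldsymbol\zeta}(t),\dot{\tilde{\boldsymbol\zeta}}(t),\ddot{\tilde{\boldsymbol\zeta}}(t),\dots\big)=\Phi\big(\boldsymbol\zeta(\tau),\boldsymbol\zeta'(\tau),\boldsymbol\zeta''(\tau),\dots\big)\Big|_{\tau=\tau(t)},$$ where dots denote derivatives with respect to $t$ and primes denote derivatives with respect to $\tau$.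
   Context: The flat state map $\Phi$ of the (quasi-static, frictionless) slider-pusher system assigns to a smooth planar curve $s\mapsto(x_s(s),y_s(s))$ with nowhere vanishing derivative (with $D=\frac{d}{ds}$ denoting differentiation with respect to the curve's parameter $s$) the state $(x_s,y_s,\theta_s,c,x_p,y_p,\theta_p)$ at each parameter value, as follows. - $\theta_s=-\arctan\frac{Dx_s}{Dy_s}$, understood quadrant-correctly, i.e. $\theta_s\in\mathbb{R}/2\pi\mathbb{Z}$ is the angle with $(-\sin\theta_s,\cos\theta_s)=\frac{(Dx_s,Dy_s)}{\sqrt{(Dx_s)^2+(Dy_s)^2}}$. - $c=\beta^2\,\dfrac{Dx_s\,D^2y_s-D^2x_s\,Dy_s}{\big((Dx_s)^2+(Dy_s)^2\big)^{3/2}}$. - $x_p=x_s+\alpha\sin\theta_s+c\cos\theta_s$ and $y_p=y_s-\alpha\cos\theta_s+c\sin\theta_s$. - $\theta_p=-\arctan\frac{Dx_p}{Dy_p}$, understood quadrant-correctly, i.e. $\theta_p\in\mathbb{R}/2\pi\mathbb{Z}$ is the angle with $(-\sin\theta_p,\cos\theta_p)=\frac{(Dx_p,Dy_p)}{\sqrt{(Dx_p)^2+(Dy_p)^2}}$ (the vector $(Dx_p,Dy_p)$ is nonzero). Each component is a function of finitely many derivatives of the curve at the given parameter value, so $\Phi$ is a function of $(\boldsymbol\zeta,D\boldsymbol\zeta,D^2\boldsymbol\zeta,D^3\boldsymbol\zeta)$. Here $\beta$ is a geometric constant of the slider and $\alpha=\tfrac b2+r$ with $b$ the slider's length and $r$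 the pusher's radius. *)

theory Defs
  imports "HOL-Analysis.Analysis" "HOL-Library.Real_Mod"
begin

quotient_type angle = real / "\<lambda>x y. [x = y] (rmod (2 * pi))"
proof (rule equivpI)
  show "reflp (\<lambda>x y. [x = y] (rmod (2 * pi)))"
    by (rule reflpI) simp
  show "symp (\<lambda>x y. [x = y] (rmod (2 * pi)))"
    by (rule sympI) (rule rcong_sym)
  show "transp (\<lambda>x y. [x = y] (rmod (2 * pi)))"
    by (rule transpI) (rule rcong_trans)
qed

lemma rcong_2pi_iff: "[x = y] (rmod (2 * pi)) \<longleftrightarrow> sin x = sin y \<and> cos x = cos y"
proof -
  have "[x = y] (rmod (2 * pi)) \<longleftrightarrow> [y = x] (rmod (2 * pi))"
    by (rule rcong_sym_iff)
  also have "\<dots> \<longleftrightarrow> (\<exists>n::int. x = y + 2 * pi * n)"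
    by (simp add: rcong_altdef mult_ac)
  also have "\<dots> \<longleftrightarrow> sin x = sin y \<and> cos x = cos y"
    by (rule sin_cos_eq_iff [symmetric])
  finally show ?thesis .
qed

lift_definition angle_sin :: "angle \<Rightarrow> real" is sin
  by (simp add: rcong_2pi_iff)

lift_definition angle_cos :: "angle \<Rightarrow> real" is cos
  by (simp add: rcong_2pi_iff)

text \<open>The quadrant-correct value of \<open>- arctan (u / w)\<close>.  It is meaningful only
  for \<open>(u, w) \<noteq> (0, 0)\<close>, see the lemma below.\<close>

definition heading :: "real \<Rightarrow> real \<Rightarrow> angle" where
  "heading u w = (THE \<theta>. (- angle_sin \<theta>, angle_cos \<theta>) =
     (u / sqrt (u\<^sup>2 + w\<^sup>2), w / sqrt (u\<^sup>2 + w\<^sup>2)))"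

lemma heading_ex1:
  assumes "(u, w) \<noteq> (0, 0)"
  shows "\<exists>!\<theta>. (- angle_sin \<theta>, angle_cos \<theta>) =
     (u / sqrt (u\<^sup>2 + w\<^sup>2), w / sqrt (u\<^sup>2 + w\<^sup>2))"
proof -
  let ?r = "sqrt (u\<^sup>2 + w\<^sup>2)"
  have pos: "u\<^sup>2 + w\<^sup>2 > 0"
    using assms by (simp add: sum_power2_gt_zero_iff)
  have "(w / ?r)\<^sup>2 + (- u / ?r)\<^sup>2 = (u\<^sup>2 + w\<^sup>2) / (u\<^sup>2 + w\<^sup>2)"
    using pos by (simp add: power_divide add.commute flip: add_divide_distrib)
  also have "\<dots> = 1"
    using pos by (intro divide_self) linarith
  finally obtain t where t: "w / ?r = cos t" "- u / ?r = sin t"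
    using sincos_total_2pi by metis
  show ?thesis
  proof (rule ex1I)
    show "(- angle_sin (abs_angle t), angle_cos (abs_angle t)) = (u / ?r, w / ?r)"
      using t by (simp add: angle_sin.abs_eq angle_cos.abs_eq flip: t)
  next
    fix \<theta>
    assume "(- angle_sin \<theta>, angle_cos \<theta>) = (u / ?r, w / ?r)"
    then have "angle_sin \<theta> = sin t" "angle_cos \<theta> = cos t"
      using t by auto
    then show "\<theta> = abs_angle t"
      by transfer (simp add: rcong_2pi_iff)
  qed
qed

text \<open>Endpoints may belong to the interval, so derivatives are relative to it (one-sided
  at endpoints).  They are unique only if the interval has more than one point.\<close>

definition proper_interval :: "real set \<Rightarrow> bool" where
  "proper_interval S \<longleftrightarrow> is_interval S \<and> (\<exists>a\<in>S. \<exists>b\<in>S. a < b)"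

definition deriv_on :: "real set \<Rightarrow> (real \<Rightarrow> 'a::real_normed_vector) \<Rightarrow> real \<Rightarrow> 'a" where
  "deriv_on S f s = vector_derivative f (at s within S)"

definition smooth_on :: "real set \<Rightarrow> (real \<Rightarrow> 'a::real_normed_vector) \<Rightarrow> bool" where
  "smooth_on S f \<longleftrightarrow> (\<forall>n. \<forall>s\<in>S. (deriv_on S ^^ n) f differentiable (at s within S))"

text \<open>In the following, \<open>S\<close> is the parameter interval and \<open>\<zeta>\<close> the curve \<open>(x\<^sub>s, y\<^sub>s)\<close>.\<close>

definition x_s :: "(real \<Rightarrow> real \<times> real) \<Rightarrow> real \<Rightarrow> real" where
  "x_s \<zeta> s = fst (\<zeta> s)"

definition y_s :: "(real \<Rightarrow> real \<times> real) \<Rightarrow> real \<Rightarrow> real" where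
  "y_s \<zeta> s = snd (\<zeta> s)"

definition theta_s :: "real set \<Rightarrow> (real \<Rightarrow> real \<times> real) \<Rightarrow> real \<Rightarrow> angle" where
  "theta_s S \<zeta> s = heading (deriv_on S (x_s \<zeta>) s) (deriv_on S (y_s \<zeta>) s)"

definition contact :: "real \<Rightarrow> real set \<Rightarrow> (real \<Rightarrow> real \<times> real) \<Rightarrow> real \<Rightarrow> real" where
  "contact \<beta> S \<zeta> s =
     (let D = deriv_on S; x = x_s \<zeta>; y = y_s \<zeta> in
      \<beta>\<^sup>2 * ((D x s * D (D y) s - D (D x) s * D y s)
             / ((D x s)\<^sup>2 + (D y s)\<^sup>2) powr (3 / 2)))"

definition x_p :: "real \<Rightarrow> real \<Rightarrow> real set \<Rightarrow> (real \<Rightarrow> real \<times> real) \<Rightarrow> real \<Rightarrow> real" where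
  "x_p \<alpha> \<beta> S \<zeta> s = x_s \<zeta> s + \<alpha> * angle_sin (theta_s S \<zeta> s)
     + contact \<beta> S \<zeta> s * angle_cos (theta_s S \<zeta> s)"

definition y_p :: "real \<Rightarrow> real \<Rightarrow> real set \<Rightarrow> (real \<Rightarrow> real \<times> real) \<Rightarrow> real \<Rightarrow> real" where
  "y_p \<alpha> \<beta> S \<zeta> s = y_s \<zeta> s - \<alpha> * angle_cos (theta_s S \<zeta> s)
     + contact \<beta> S \<zeta> s * angle_sin (theta_s S \<zeta> s)"

definition theta_p :: "real \<Rightarrow> real \<Rightarrow> real set \<Rightarrow> (real \<Rightarrow> real \<times> real) \<Rightarrow> real \<Rightarrow> angle" where
  "theta_p \<alpha> \<beta> S \<zeta> s =
     heading (deriv_on S (x_p \<alpha> \<beta> S \<zeta>) s) (deriv_on S (y_p \<alpha> \<beta> S \<zeta>) s)"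

text \<open>The value of \<open>\<Phi>\<close> on the derivatives of \<open>\<zeta>\<close> at the parameter \<open>s\<close>, all derivatives
  being taken with respect to the parameter of \<open>\<zeta>\<close>.\<close>

definition flat_state ::
    "real \<Rightarrow> real \<Rightarrow> real set \<Rightarrow> (real \<Rightarrow> real \<times> real) \<Rightarrow> real
      \<Rightarrow> real \<times> real \<times> angle \<times> real \<times> real \<times> real \<times> angle" where
  "flat_state \<alpha> \<beta> S \<zeta> s =
     (x_s \<zeta> s, y_s \<zeta> s, theta_s S \<zeta> s, contact \<beta> S \<zeta> s,
      x_p \<alpha> \<beta> S \<zeta> s, y_p \<alpha> \<beta> S \<zeta> s, theta_p \<alpha> \<beta> S \<zeta> s)"

end

theory Submission
  imports Defs
begin

text \<open>Put \<open>k = d\<tau>/dt > 0\<close>. By the chain rule the reparametrized curve has first derivative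
  \<open>k *\<^sub>R \<zeta>'\<close> and second derivative \<open>k\<^sup>2 *\<^sub>R \<zeta>'' + k' *\<^sub>R \<zeta>'\<close>. A heading does not change under
  positive scaling; in the determinant of the contact offset the \<open>k'\<close> terms cancel, so its numerator
  and its denominator both scale by \<open>k\<^sup>3\<close>. Hence the pusher position is a function of the point on
  the path; being differentiable, it obeys the chain rule as well, and its heading is invariant by
  the same scaling argument.\<close>

section \<open>Derivatives relative to an interval\<close>

text \<open>A connected set with more than one point has no isolated points, so
  \<open>at s within S\<close> is a nontrivial filter and the relative derivative is unique.\<close>

lemma deriv_on_eqI:
  assumes "proper_interval S" "s \<in> S" "(f has_vector_derivative d) (at s within S)"
  shows "deriv_on S f s = d"
proof -
  have "connected S"
    using assms(1) by (simp add: proper_interval_def is_interval_connected)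
  moreover have "S \<noteq> {s}"
    using assms(1) by (auto simp: proper_interval_def)
  ultimately have "s islimpt S"
    using assms(2) by (intro connected_imp_perfect) blast+
  then have "at s within S \<noteq> bot"
    using trivial_limit_within by blast
  then show ?thesis
    unfolding deriv_on_def using assms(3) by (rule vector_derivative_within)
qed

lemma has_vector_derivative_deriv_on:
  "f differentiable (at s within S) \<Longrightarrow>
    (f has_vector_derivative deriv_on S f s) (at s within S)"
  by (simp add: deriv_on_def vector_derivative_works)

lemma smooth_on_differentiable:
  "smooth_on S f \<Longrightarrow> s \<in> S \<Longrightarrow> f differentiable (at s within S)"
  unfolding smooth_on_def by (drule spec[of _ 0]) simp

lemma smooth_on_deriv_on: "smooth_on S f \<Longrightarrow> smooth_on S (deriv_on S f)"
  unfolding smooth_on_def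
proof (intro allI ballI)
  fix n s
  assume "\<forall>n. \<forall>s\<in>S. (deriv_on S ^^ n) f differentiable (at s within S)" "s \<in> S"
  then have "(deriv_on S ^^ Suc n) f differentiable (at s within S)"
    by blast
  then show "(deriv_on S ^^ n) (deriv_on S f) differentiable (at s within S)"
    by (simp add: funpow_swap1)
qed

lemma has_vector_derivative_deriv_on_smooth:
  "smooth_on S f \<Longrightarrow> s \<in> S \<Longrightarrow> (f has_vector_derivative deriv_on S f s) (at s within S)"
  by (simp add: has_vector_derivative_deriv_on smooth_on_differentiable)

text \<open>Meant for the coordinate projections. Agreement of \<open>g\<close> with
  \<open>h (f u)\<close> is asked on \<open>S\<close> only, so that the rule also applies to
  iterated derivatives.\<close>

lemma deriv_on_linear:
  assumes "proper_interval S" "s \<in> S" "smooth_on S f" "bounded_linear h"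
    and "\<And>u. u \<in> S \<Longrightarrow> g u = h (f u)"
  shows "(g has_vector_derivative h (deriv_on S f s)) (at s within S)"
    and "deriv_on S g s = h (deriv_on S f s)"
proof -
  have "((\<lambda>u. h (f u)) has_vector_derivative h (deriv_on S f s)) (at s within S)"
    by (rule bounded_linear.has_vector_derivative[OF assms(4)
          has_vector_derivative_deriv_on_smooth[OF assms(3,2)]])
  then show "(g has_vector_derivative h (deriv_on S f s)) (at s within S)"
    using assms by (auto intro: has_vector_derivative_transform)
  then show "deriv_on S g s = h (deriv_on S f s)"
    using assms by (intro deriv_on_eqI)
qed

lemma smooth_on_linear:
  assumes "proper_interval S" "smooth_on S f" "bounded_linear h"
  shows "smooth_on S (\<lambda>u. h (f u))"
proof -
  have smooth: "smooth_on S ((deriv_on S ^^ n) f)" for n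
    by (induction n) (simp_all add: assms smooth_on_deriv_on)
  \<comment> \<open>The commutation is claimed on \<open>S\<close> only: at other points
    \<open>deriv_on S\<close> is not controlled.\<close>
  have eq: "\<forall>u\<in>S. (deriv_on S ^^ n) (\<lambda>u. h (f u)) u = h ((deriv_on S ^^ n) f u)" for n
  proof (induction n)
    case (Suc n)
    then show ?case
      using deriv_on_linear(2)[OF assms(1) _ smooth assms(3)] by simp
  qed simp
  show ?thesis
    unfolding smooth_on_def
  proof (intro allI ballI)
    fix n s
    assume "s \<in> S"
    then show "(deriv_on S ^^ n) (\<lambda>u. h (f u)) differentiable (at s within S)"
      using eq by (intro differentiableI_vector[OF deriv_on_linear(1)[OF assms(1) _ smooth assms(3)]]) auto
  qed
qed

lemma
  assumes "proper_interval S" "smooth_on S \<zeta>"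
  shows smooth_on_x_s: "smooth_on S (x_s \<zeta>)"
    and smooth_on_y_s: "smooth_on S (y_s \<zeta>)"
  using smooth_on_linear[OF assms bounded_linear_fst] smooth_on_linear[OF assms bounded_linear_snd]
  by (simp_all add: x_s_def[abs_def] y_s_def[abs_def])

lemma deriv_on_coordinates_nonzero:
  assumes "proper_interval S" "smooth_on S \<zeta>" "s \<in> S" "deriv_on S \<zeta> s \<noteq> 0"
  shows "(deriv_on S (x_s \<zeta>) s, deriv_on S (y_s \<zeta>) s) \<noteq> (0, 0)"
proof -
  have "deriv_on S (x_s \<zeta>) s = fst (deriv_on S \<zeta> s)"
    by (rule deriv_on_linear(2)[OF assms(1,3,2) bounded_linear_fst]) (simp add: x_s_def)
  moreover have "deriv_on S (y_s \<zeta>) s = snd (deriv_on S \<zeta> s)"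
    by (rule deriv_on_linear(2)[OF assms(1,3,2) bounded_linear_snd]) (simp add: y_s_def)
  ultimately show ?thesis
    using assms(4) by (simp add: prod_eq_iff)
qed

section \<open>Chain rules for a change of parameter\<close>

lemma has_vector_derivative_reparam:
  assumes "\<tau> differentiable (at t within K)" "\<tau> ` K \<subseteq> I"
    and "f differentiable (at (\<tau> t) within I)"
  shows "((\<lambda>t. f (\<tau> t)) has_vector_derivative deriv_on K \<tau> t *\<^sub>R deriv_on I f (\<tau> t)) (at t within K)"
  using vector_diff_chain_within[OF has_vector_derivative_deriv_on[OF assms(1)]
      has_vector_derivative_within_subset[OF has_vector_derivative_deriv_on[OF assms(3)] assms(2)]]
  by (simp add: o_def)

text \<open>A separate \<open>g\<close> covers functions that are known to agree with the composite
  only on \<open>K\<close>, such as the pusher coordinates.\<close>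

lemma deriv_on_reparam:
  assumes "proper_interval K" "t \<in> K" "\<tau> differentiable (at t within K)" "\<tau> ` K \<subseteq> I"
    and "f differentiable (at (\<tau> t) within I)"
    and "\<And>t. t \<in> K \<Longrightarrow> g t = f (\<tau> t)"
  shows "deriv_on K g t = deriv_on K \<tau> t *\<^sub>R deriv_on I f (\<tau> t)"
proof (rule deriv_on_eqI)
  show "(g has_vector_derivative deriv_on K \<tau> t *\<^sub>R deriv_on I f (\<tau> t)) (at t within K)"
    using assms has_vector_derivative_reparam[of \<tau> t K I f]
    by (auto intro: has_vector_derivative_transform)
qed (use assms in auto)

text \<open>Product rule applied to the first-order formula: one factor
  \<open>deriv_on K \<tau>\<close> comes from that formula, the other from the chain rule for
  \<open>deriv_on I f\<close>.\<close>

lemma deriv_on_deriv_on_reparam: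
  assumes "proper_interval K" "t \<in> K" "smooth_on K \<tau>" "\<tau> ` K \<subseteq> I" "smooth_on I f"
    and "\<And>t. t \<in> K \<Longrightarrow> g t = f (\<tau> t)"
  shows "deriv_on K (deriv_on K g) t =
    (deriv_on K \<tau> t)\<^sup>2 *\<^sub>R deriv_on I (deriv_on I f) (\<tau> t)
      + deriv_on K (deriv_on K \<tau>) t *\<^sub>R deriv_on I f (\<tau> t)"
proof (rule deriv_on_eqI)
  have "(deriv_on K \<tau> has_field_derivative deriv_on K (deriv_on K \<tau>) t) (at t within K)"
    using has_vector_derivative_deriv_on_smooth[OF smooth_on_deriv_on[OF assms(3)] assms(2)]
    by (simp add: has_real_derivative_iff_has_vector_derivative)
  moreover have "((\<lambda>t. deriv_on I f (\<tau> t)) has_vector_derivative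
      deriv_on K \<tau> t *\<^sub>R deriv_on I (deriv_on I f) (\<tau> t)) (at t within K)"
    using assms by (intro has_vector_derivative_reparam smooth_on_differentiable smooth_on_deriv_on) auto
  ultimately have "((\<lambda>t. deriv_on K \<tau> t *\<^sub>R deriv_on I f (\<tau> t)) has_vector_derivative
      (deriv_on K \<tau> t)\<^sup>2 *\<^sub>R deriv_on I (deriv_on I f) (\<tau> t)
      + deriv_on K (deriv_on K \<tau>) t *\<^sub>R deriv_on I f (\<tau> t)) (at t within K)"
    by (auto dest: has_vector_derivative_scaleR simp: power2_eq_square)
  \<comment> \<open>The first-order formula holds throughout \<open>K\<close>, so its right-hand
    side may be differentiated in place of \<open>deriv_on K g\<close>.\<close>
  moreover have "deriv_on K g u = deriv_on K \<tau> u *\<^sub>R deriv_on I f (\<tau> u)" if "u \<in> K" for u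
    using assms that by (intro deriv_on_reparam smooth_on_differentiable) auto
  ultimately show "(deriv_on K g has_vector_derivative
      (deriv_on K \<tau> t)\<^sup>2 *\<^sub>R deriv_on I (deriv_on I f) (\<tau> t)
      + deriv_on K (deriv_on K \<tau>) t *\<^sub>R deriv_on I f (\<tau> t)) (at t within K)"
    using assms(2) by (auto intro: has_vector_derivative_transform)
qed (use assms in auto)

lemma differentiable_transform:
  assumes "f differentiable (at s within S)" "\<And>u. u \<in> S \<Longrightarrow> g u = f u" "s \<in> S"
  shows "g differentiable (at s within S)"
  using differentiable_transform_within[OF assms(1) zero_less_one assms(3)] assms(2) by simp

section \<open>Headings and contact offset\<close>

text \<open>The norm scales by the same \<open>k\<close>, which cancels in the unit vector, so both
  definite descriptions have the same body. Positivity gives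
  \<open>sqrt (k\<^sup>2) = k\<close>.\<close>

lemma heading_scale:
  assumes "k > 0"
  shows "heading (k * u) (k * w) = heading u w"
proof -
  have "sqrt ((k * u)\<^sup>2 + (k * w)\<^sup>2) = k * sqrt (u\<^sup>2 + w\<^sup>2)"
    using assms by (simp add: power_mult_distrib real_sqrt_mult flip: distrib_left)
  then show ?thesis
    unfolding heading_def using assms by simp
qed

text \<open>These replace the angle by explicit quotients, so that the pusher position can be
  differentiated without differentiating an angle.\<close>

lemma
  assumes "(u, w) \<noteq> (0, 0)"
  shows angle_sin_heading: "angle_sin (heading u w) = - (u / sqrt (u\<^sup>2 + w\<^sup>2))"
    and angle_cos_heading: "angle_cos (heading u w) = w / sqrt (u\<^sup>2 + w\<^sup>2)"
proof -
  have "(- angle_sin (heading u w), angle_cos (heading u w)) =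
      (u / sqrt (u\<^sup>2 + w\<^sup>2), w / sqrt (u\<^sup>2 + w\<^sup>2))"
    unfolding heading_def by (rule theI'[OF heading_ex1[OF assms]])
  then show "angle_sin (heading u w) = - (u / sqrt (u\<^sup>2 + w\<^sup>2))"
    and "angle_cos (heading u w) = w / sqrt (u\<^sup>2 + w\<^sup>2)"
    by auto
qed

lemma powr_three_halves: "x \<ge> 0 \<Longrightarrow> x powr (3 / 2) = sqrt x ^ 3"
proof -
  assume "x \<ge> 0"
  then have "sqrt x ^ 3 = sqrt x powr 3"
    by simp
  also have "\<dots> = x powr (3 / 2)"
    using \<open>x \<ge> 0\<close> by (simp add: powr_powr flip: powr_half_sqrt)
  finally show ?thesis ..
qed

text \<open>Here \<open>(a, b)\<close> and \<open>(a', b')\<close> stand for the first and second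
  derivatives of the path, \<open>k\<close> and \<open>l\<close> for those of
  \<open>\<tau>\<close>.\<close>

lemma curvature_scale:
  fixes k :: real
  assumes "k > 0"
  shows "((k * a) * (k\<^sup>2 * b' + l * b) - (k\<^sup>2 * a' + l * a) * (k * b))
      / ((k * a)\<^sup>2 + (k * b)\<^sup>2) powr (3 / 2)
    = (a * b' - a' * b) / (a\<^sup>2 + b\<^sup>2) powr (3 / 2)"
proof -
  have "(k * a) * (k\<^sup>2 * b' + l * b) - (k\<^sup>2 * a' + l * a) * (k * b) = k ^ 3 * (a * b' - a' * b)"
    by (simp add: algebra_simps power2_eq_square power3_eq_cube)
  moreover have "((k * a)\<^sup>2 + (k * b)\<^sup>2) powr (3 / 2) = k ^ 3 * (a\<^sup>2 + b\<^sup>2) powr (3 / 2)"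
    using assms
    by (simp add: powr_three_halves power_mult_distrib real_sqrt_mult flip: distrib_left)
  ultimately show ?thesis
    using assms by simp
qed

section \<open>Differentiability of the pusher position\<close>

lemma differentiable_sqrt:
  fixes f :: "real \<Rightarrow> real"
  assumes "f differentiable (at s within S)" "f s > 0"
  shows "(\<lambda>u. sqrt (f u)) differentiable (at s within S)"
proof (rule differentiable_compose[OF _ assms(1)])
  show "sqrt differentiable (at (f s))"
    unfolding real_differentiable_def by (rule exI, rule DERIV_real_sqrt[OF assms(2)])
qed

text \<open>The chain rule behind \<open>theta_p\<close> needs this. On \<open>S\<close> the pusher
  coordinates are built from the path and its first two derivatives by arithmetic and a square root
  of a positive quantity.\<close>

lemma
  assumes "proper_interval S" "smooth_on S \<zeta>" "\<And>s. s \<in> S \<Longrightarrow> deriv_on S \<zeta> s \<noteq> 0" "s \<in> S"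
  shows differentiable_x_p: "x_p \<alpha> \<beta> S \<zeta> differentiable (at s within S)"
    and differentiable_y_p: "y_p \<alpha> \<beta> S \<zeta> differentiable (at s within S)"
proof -
  define a b a' b' where "a = deriv_on S (x_s \<zeta>)" "b = deriv_on S (y_s \<zeta>)"
    "a' = deriv_on S a" "b' = deriv_on S b"
  note defs = this
  \<comment> \<open>\<open>r\<close> is the speed of the path; \<open>c\<close> is the contact
    offset with the power 3/2 written as a cube of \<open>r\<close>, to which the power and quotient
    rules apply.\<close>
  define r where "r = (\<lambda>u. sqrt ((a u)\<^sup>2 + (b u)\<^sup>2))"
  define c where "c = (\<lambda>u. \<beta>\<^sup>2 * ((a u * b' u - a' u * b u) / r u ^ 3))"
  have nonzero: "(a u, b u) \<noteq> (0, 0)" if "u \<in> S" for u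
    using deriv_on_coordinates_nonzero[OF assms(1,2) that assms(3)[OF that]] by (simp add: defs)
  have pos: "(a s)\<^sup>2 + (b s)\<^sup>2 > 0"
    using nonzero[OF assms(4)] by (simp add: sum_power2_gt_zero_iff)
  note smooth_x = smooth_on_x_s[OF assms(1,2)] and smooth_y = smooth_on_y_s[OF assms(1,2)]
  have diff:
    "x_s \<zeta> differentiable (at s within S)" "y_s \<zeta> differentiable (at s within S)"
    "a differentiable (at s within S)" "b differentiable (at s within S)"
    "a' differentiable (at s within S)" "b' differentiable (at s within S)"
    unfolding defs
    by (intro smooth_on_differentiable[OF _ assms(4)] smooth_on_deriv_on smooth_x smooth_y)+
  have diff_r: "r differentiable (at s within S)"
    unfolding r_def
    by (intro differentiable_sqrt differentiable_add differentiable_power diff pos)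
  have r_nonzero: "r s \<noteq> 0"
    using nonzero[OF assms(4)] by (auto simp: r_def)
  have diff_c: "c differentiable (at s within S)"
    unfolding c_def using r_nonzero
    by (intro differentiable_mult differentiable_divide differentiable_diff differentiable_power
        differentiable_const diff diff_r) simp
  have contact: "contact \<beta> S \<zeta> u = c u" for u
    by (simp add: contact_def c_def r_def defs Let_def powr_three_halves)
  have "(\<lambda>u. x_s \<zeta> u + \<alpha> * - (a u / r u) + c u * (b u / r u)) differentiable (at s within S)"
    by (intro differentiable_add differentiable_mult differentiable_minus differentiable_divide
        differentiable_const diff diff_r diff_c r_nonzero)
  \<comment> \<open>The nonzero velocity on \<open>S\<close> makes the heading meaningful and allows
    the quotient formulas.\<close>
  moreover have "x_p \<alpha> \<beta> S \<zeta> u = x_s \<zeta> u + \<alpha> * - (a u / r u) + c u * (b u / r u)" if "u \<in> S" for u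
    using nonzero[OF that]
    by (simp add: x_p_def contact theta_s_def r_def angle_sin_heading angle_cos_heading flip: defs)
  ultimately show "x_p \<alpha> \<beta> S \<zeta> differentiable (at s within S)"
    using assms(4) by (rule differentiable_transform)
  have "(\<lambda>u. y_s \<zeta> u - \<alpha> * (b u / r u) + c u * - (a u / r u)) differentiable (at s within S)"
    by (intro differentiable_add differentiable_diff differentiable_mult differentiable_minus
        differentiable_divide differentiable_const diff diff_r diff_c r_nonzero)
  moreover have "y_p \<alpha> \<beta> S \<zeta> u = y_s \<zeta> u - \<alpha> * (b u / r u) + c u * - (a u / r u)" if "u \<in> S" for u
    using nonzero[OF that]
    by (simp add: y_p_def contact theta_s_def r_def angle_sin_heading angle_cos_heading flip: defs)
  ultimately show "y_p \<alpha> \<beta> S \<zeta> differentiable (at s within S)"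
    using assms(4) by (rule differentiable_transform)
qed

section \<open>Invariance of the state, component by component\<close>

theorem theorem2:
  fixes \<alpha> \<beta> :: real
    and I K :: "real set"
    and \<zeta> :: "real \<Rightarrow> real \<times> real"
    and \<tau> :: "real \<Rightarrow> real"
  assumes "\<beta> > 0" and "\<alpha> > 0"
    and "proper_interval I"
    and "smooth_on I \<zeta>"
    and "\<And>u. u \<in> I \<Longrightarrow> deriv_on I \<zeta> u \<noteq> 0"
    and "proper_interval K"
    and "\<And>t. t \<in> K \<Longrightarrow> \<tau> t \<in> I"
    and "smooth_on K \<tau>"
    and "\<And>t. t \<in> K \<Longrightarrow> deriv_on K \<tau> t > 0"
  shows "\<forall>t\<in>K. flat_state \<alpha> \<beta> K (\<lambda>t. \<zeta> (\<tau> t)) t = flat_state \<alpha> \<beta> I \<zeta> (\<tau> t)"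
proof -
  let ?\<eta> = "\<lambda>t. \<zeta> (\<tau> t)"
  have image: "\<tau> ` K \<subseteq> I"
    using assms(7) by auto
  have x: "x_s ?\<eta> t = x_s \<zeta> (\<tau> t)" and y: "y_s ?\<eta> t = y_s \<zeta> (\<tau> t)" for t
    by (simp_all add: x_s_def y_s_def)
  \<comment> \<open>Real-valued chain rule, used first for the slider coordinates and later for the
    pusher coordinates.\<close>
  have D: "deriv_on K g t = deriv_on K \<tau> t * deriv_on I f (\<tau> t)"
    if "t \<in> K" "f differentiable (at (\<tau> t) within I)" "\<And>t. t \<in> K \<Longrightarrow> g t = f (\<tau> t)"
    for f g :: "real \<Rightarrow> real" and t
    using deriv_on_reparam[OF assms(6) that(1) smooth_on_differentiable[OF assms(8) that(1)] image that(2)]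
      that(3) by simp
  note smooth_x = smooth_on_x_s[OF assms(3,4)] and smooth_y = smooth_on_y_s[OF assms(3,4)]
  have Dx: "deriv_on K (x_s ?\<eta>) t = deriv_on K \<tau> t * deriv_on I (x_s \<zeta>) (\<tau> t)"
    and Dy: "deriv_on K (y_s ?\<eta>) t = deriv_on K \<tau> t * deriv_on I (y_s \<zeta>) (\<tau> t)" if "t \<in> K" for t
    using that assms(7) smooth_x smooth_y x y by (intro D smooth_on_differentiable; simp)+
  have theta_s: "theta_s K ?\<eta> t = theta_s I \<zeta> (\<tau> t)" if "t \<in> K" for t
    using that by (simp add: theta_s_def Dx Dy heading_scale assms(9))
  \<comment> \<open>The two chain rules bring the offset into the shape of
    \<open>curvature_scale\<close>, with \<open>k\<close> and \<open>l\<close> the first and second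
    derivatives of \<open>\<tau>\<close> at \<open>t\<close>.\<close>
  have contact: "contact \<beta> K ?\<eta> t = contact \<beta> I \<zeta> (\<tau> t)" if "t \<in> K" for t
    by (simp only: contact_def Let_def Dx[OF that] Dy[OF that] real_scaleR_def
        deriv_on_deriv_on_reparam[OF assms(6) that assms(8) image smooth_x x]
        deriv_on_deriv_on_reparam[OF assms(6) that assms(8) image smooth_y y]
        curvature_scale[OF assms(9)[OF that]])
  have x_p: "x_p \<alpha> \<beta> K ?\<eta> t = x_p \<alpha> \<beta> I \<zeta> (\<tau> t)"
    and y_p: "y_p \<alpha> \<beta> K ?\<eta> t = y_p \<alpha> \<beta> I \<zeta> (\<tau> t)" if "t \<in> K" for t
    using that by (simp_all add: x_p_def y_p_def x y theta_s contact)
  \<comment> \<open>Since \<open>x_p\<close> and \<open>y_p\<close> get differentiated, their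
    invariance is used on all of \<open>K\<close>, not just at \<open>t\<close>; both derivatives
    then pick up the same positive factor.\<close>
  have theta_p: "theta_p \<alpha> \<beta> K ?\<eta> t = theta_p \<alpha> \<beta> I \<zeta> (\<tau> t)" if "t \<in> K" for t
    using that assms(7)
      D[OF that differentiable_x_p[OF assms(3,4,5)] x_p]
      D[OF that differentiable_y_p[OF assms(3,4,5)] y_p]
    by (simp add: theta_p_def heading_scale assms(9))
  show ?thesis
    by (simp add: flat_state_def x y theta_s contact x_p y_p theta_p)
qed

end
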